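(* Let $k\ge 1$ and $n\ge m\ge 1$ be integers, and suppose that either (1) $m=n=1$, or (2) $m<n$. Then \[R_k(\mathbf{V}_{m,n})=nk+1.\]
   Context: The Boolean lattice $\mathbf{B}_N$ is the poset $(2^{[N]},\subseteq)$ of all subsets of $[N]=\{1,\dots,N\}$ ordered by inclusion. A poset $\mathbf{Q}$ contains a poset $\mathbf{P}$ as a subposet if there is an injection $\phi$ from the elements of $\mathbf{P}$ to those of $\mathbf{Q}$ with $x\le_{\mathbf{P}} y$ if and only if $\phi(x)\le_{\mathbf{Q}}\phi(y)$. For integers $n\ge m\ge 1$, $\mathbf{V}_{m,n}$ is the poset on $m+n+1$ elements $x,y_1,\dots,y_m,z_1,\dots,z_n$ whose order relations are generated by $x<y_1<\cdots<y_m$ and $x<z_1<\cdots<z_n$ (so each $y_p$ is incomparable to each $z_q$). For posets $\mathbf{P}_1,\dots,\mathbf{P}_k$, $R(\mathbf{P}_1,\dots,\mathbf{P}_k)$ is the minimum $N$ such that for every coloring $c:2^{[N]}\to[k]$, there is some $i\in[k]$ such that $\mathbf{B}_N$ contains a subposet isomorphic to $\mathbf{P}_i$ all of whose elements have color $i$. $R_k(\mathbf{P})$ denotes $R(\mathbf{P},\dots,\mathbf{P})$ with $k$ copies of $\mathbf{P}$. *)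

theory Defs
  imports "HOL-Library.FuncSet" "HOL-Library.Extended_Nat"
begin

text \<open>
  A poset is given by its reflexive order relation \<open>r\<close>, that is \<open>Partial_order r\<close>;
  its set of elements is \<open>Field r\<close>.
\<close>

definition boolean_lattice :: "nat \<Rightarrow> nat set rel" where
  "boolean_lattice N = {(A, B). A \<in> Pow {1..N} \<and> B \<in> Pow {1..N} \<and> A \<subseteq> B}"

definition poset_embedding :: "'a rel \<Rightarrow> 'b rel \<Rightarrow> ('a \<Rightarrow> 'b) \<Rightarrow> bool" where
  "poset_embedding P Q \<phi> \<longleftrightarrow>
     \<phi> \<in> Field P \<rightarrow> Field Q \<and> inj_on \<phi> (Field P) \<and>
     (\<forall>x\<in>Field P. \<forall>y\<in>Field P. (x, y) \<in> P \<longleftrightarrow> (\<phi> x, \<phi> y) \<in> Q)"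

definition ramsey_property :: "nat \<Rightarrow> (nat \<Rightarrow> 'a rel) \<Rightarrow> nat \<Rightarrow> bool" where
  "ramsey_property k P N \<longleftrightarrow>
     (\<forall>c \<in> Pow {1..N} \<rightarrow> {1..k}. \<exists>i\<in>{1..k}. \<exists>\<phi>.
        poset_embedding (P i) (boolean_lattice N) \<phi> \<and> (\<forall>x\<in>Field (P i). c (\<phi> x) = i))"

text \<open>
  The infimum is taken in \<^typ>\<open>enat\<close>: it is the minimum if some \<open>N\<close> has the property,
  and \<open>\<infinity>\<close> otherwise.
\<close>

definition poset_ramsey :: "nat \<Rightarrow> (nat \<Rightarrow> 'a rel) \<Rightarrow> enat" where
  "poset_ramsey k P = Inf (enat ` {N. ramsey_property k P N})"

definition poset_ramsey_diag :: "nat \<Rightarrow> 'a rel \<Rightarrow> enat" where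
  "poset_ramsey_diag k P = poset_ramsey k (\<lambda>_. P)"

datatype V_elem = V_x | V_y nat | V_z nat

definition V_carrier :: "nat \<Rightarrow> nat \<Rightarrow> V_elem set" where
  "V_carrier m n = {V_x} \<union> V_y ` {1..m} \<union> V_z ` {1..n}"

definition V_gen :: "nat \<Rightarrow> nat \<Rightarrow> V_elem rel" where
  "V_gen m n = {(V_x, V_y 1), (V_x, V_z 1)}
     \<union> {(V_y p, V_y (p + 1)) | p. 1 \<le> p \<and> p < m}
     \<union> {(V_z q, V_z (q + 1)) | q. 1 \<le> q \<and> q < n}"

text \<open>
  The restriction to the carrier discards the pairs \<open>(a, a)\<close> with \<open>a\<close> outside it, which
  the reflexive transitive closure contains.
\<close>

definition V_poset :: "nat \<Rightarrow> nat \<Rightarrow> V_elem rel" where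
  "V_poset m n = Restr ((V_gen m n)\<^sup>*) (V_carrier m n)"

lemma Field_boolean_lattice: "Field (boolean_lattice N) = Pow {1..N}"
  by (auto simp: boolean_lattice_def Field_def)

lemma Partial_order_boolean_lattice: "Partial_order (boolean_lattice N)"
  unfolding Field_boolean_lattice
  by (auto simp: boolean_lattice_def partial_order_on_def preorder_on_def
      refl_on_def trans_def antisym_def)

lemma Field_V_poset: "Field (V_poset m n) = V_carrier m n"
  by (auto simp: V_poset_def Field_def)

lemma card_V_carrier: "card (V_carrier m n) = m + n + 1"
proof -
  have "card (V_y ` {1..m} \<union> V_z ` {1..n}) = m + n"
    by (subst card_Un_disjoint) (auto simp: card_image inj_on_def)
  moreover have "V_carrier m n = insert V_x (V_y ` {1..m} \<union> V_z ` {1..n})"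
    by (auto simp: V_carrier_def)
  ultimately show ?thesis
    by (simp add: image_iff)
qed

fun V_le :: "V_elem \<Rightarrow> V_elem \<Rightarrow> bool" where
  "V_le V_x b \<longleftrightarrow> True"
| "V_le (V_y p) (V_y q) \<longleftrightarrow> p \<le> q"
| "V_le (V_z p) (V_z q) \<longleftrightarrow> p \<le> q"
| "V_le _ _ \<longleftrightarrow> False"

lemma V_le_trans: "V_le a b \<Longrightarrow> V_le b c \<Longrightarrow> V_le a c"
  by (cases a; cases b; cases c) auto

lemma V_le_refl: "V_le a a"
  by (cases a) auto

lemma V_le_antisym: "V_le a b \<Longrightarrow> V_le b a \<Longrightarrow> a = b"
  by (cases a; cases b) auto

lemma V_y_chain:
  assumes "1 \<le> p" "p \<le> q" "q \<le> m"
  shows "(V_y p, V_y q) \<in> (V_gen m n)\<^sup>*"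
  using assms(2,3)
proof (induction rule: dec_induct)
  case (step q)
  then have "(V_y q, V_y (Suc q)) \<in> V_gen m n"
    using assms(1) by (auto simp: V_gen_def)
  with step show ?case
    by (auto intro: rtrancl_into_rtrancl)
qed auto

lemma V_z_chain:
  assumes "1 \<le> p" "p \<le> q" "q \<le> n"
  shows "(V_z p, V_z q) \<in> (V_gen m n)\<^sup>*"
  using assms(2,3)
proof (induction rule: dec_induct)
  case (step q)
  then have "(V_z q, V_z (Suc q)) \<in> V_gen m n"
    using assms(1) by (auto simp: V_gen_def)
  with step show ?case
    by (auto intro: rtrancl_into_rtrancl)
qed auto

lemma V_poset_iff:
  "(a, b) \<in> V_poset m n \<longleftrightarrow> a \<in> V_carrier m n \<and> b \<in> V_carrier m n \<and> V_le a b"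
proof -
  have "V_le a b" if "(a, b) \<in> (V_gen m n)\<^sup>*"
    using that
  proof (induction rule: rtrancl_induct)
    case (step b c)
    then have "V_le b c"
      by (auto simp: V_gen_def)
    with step show ?case
      using V_le_trans by blast
  qed (rule V_le_refl)
  moreover have "(a, b) \<in> (V_gen m n)\<^sup>*"
    if ab: "a \<in> V_carrier m n" "b \<in> V_carrier m n" "V_le a b"
  proof -
    have "(V_x, V_y 1) \<in> V_gen m n" "(V_x, V_z 1) \<in> V_gen m n"
      by (auto simp: V_gen_def)
    then show ?thesis
      using ab V_y_chain V_z_chain
      by (cases a; cases b)
        (auto simp: V_carrier_def intro: converse_rtrancl_into_rtrancl)
  qed
  ultimately show ?thesis
    by (auto simp: V_poset_def)
qed

lemma Partial_order_V_poset: "Partial_order (V_poset m n)"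
  unfolding Field_V_poset partial_order_on_def preorder_on_def refl_on_def trans_def antisym_def
  using V_le_refl V_le_trans V_le_antisym
  by (auto simp: V_poset_iff)

end

theory Submission imports Defs begin

text \<open>
  Lower bound: for \<open>N \<le> n k\<close> colour \<open>A\<close> by \<open>min (|A| div n + 1) k\<close>. Only the last colour
  can occupy \<open>n + 1\<close> levels, and then the largest element of a chain through all of them is
  \<open>[N]\<close>, which lies above everything.

  Upper bound: descend through half-open intervals \<open>[X, Y)\<close>, starting with \<open>[\<emptyset>, [N])\<close>, and
  give each colour a budget bounding the length of its chains in the interval; a colour not
  met yet has budget \<open>n\<close>. When \<open>X\<close> has a colour met before, add any point to \<open>X\<close>: both the
  dimension and the budget of that colour drop by one. When the colour \<open>i\<close> of \<open>X\<close> is new and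
  there is no chain \<open>w\<^sub>1 \<subset> \<dots> \<subset> w\<^sub>n\<close> of colour \<open>i\<close> strictly between \<open>X\<close> and \<open>Y\<close>, do the same.
  Otherwise, if \<open>m < n\<close>, pick \<open>b \<in> Y - w\<^sub>n\<close> and \<open>q \<in> w\<^sub>1 - X\<close>: every member of
  \<open>[X \<union> {b}, Y - {q})\<close> is incomparable to every \<open>w\<^sub>j\<close>, so a chain of \<open>m\<close> sets of colour \<open>i\<close>
  there would complete a copy of \<open>V\<^sub>m\<^sub>,\<^sub>n\<close>. Two dimensions are lost, but the budget drops from
  \<open>n\<close> to \<open>m - 1 \<le> n - 2\<close>. (For \<open>m = n = 1\<close> take \<open>w\<^sub>1\<close> maximal: then \<open>[X \<union> {b}, Y)\<close> contains no
  set of colour \<open>i\<close> at all.) So if the sum of the budgets starts below the dimension, it stays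
  below it. This is absurd, since the dimension reaches zero.
\<close>

section \<open>Chains, half-open intervals and copies of the poset in set families\<close>

definition has_chain :: "'a set set \<Rightarrow> nat \<Rightarrow> bool" where
  "has_chain F l \<longleftrightarrow> (\<exists>f. f \<in> {1..l} \<rightarrow> F \<and> strict_mono_on {1..l} f)"

text \<open>The top is left out because the descent needs a point of \<open>Y\<close> outside the
  largest set of a chain found in the interval.\<close>

definition seg :: "'a set set \<Rightarrow> 'a set \<Rightarrow> 'a set \<Rightarrow> 'a set set" where
  "seg F X Y = {A \<in> F. X \<subseteq> A \<and> A \<subset> Y}"

text \<open>A copy of \<open>V_poset m n\<close> under inclusion, split into bottom and two arms so
  that chains found separately can be combined.\<close>

definition has_V :: "'a set set \<Rightarrow> nat \<Rightarrow> nat \<Rightarrow> bool" where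
  "has_V F m n \<longleftrightarrow> (\<exists>x\<in>F. \<exists>f g.
     f \<in> {1..m} \<rightarrow> F \<and> strict_mono_on {1..m} f \<and>
     g \<in> {1..n} \<rightarrow> F \<and> strict_mono_on {1..n} g \<and>
     (\<forall>p\<in>{1..m}. x \<subset> f p) \<and> (\<forall>q\<in>{1..n}. x \<subset> g q) \<and>
     (\<forall>p\<in>{1..m}. \<forall>q\<in>{1..n}. \<not> f p \<subseteq> g q \<and> \<not> g q \<subseteq> f p))"

lemma seg_mono: "X \<subseteq> X' \<Longrightarrow> Y' \<subseteq> Y \<Longrightarrow> seg F X' Y' \<subseteq> seg F X Y"
  by (auto simp: seg_def)

lemma has_chain_mono: "has_chain F l \<Longrightarrow> F \<subseteq> G \<Longrightarrow> has_chain G l"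
  unfolding has_chain_def by blast

lemma has_chain_one: "has_chain F (Suc 0) \<longleftrightarrow> F \<noteq> {}"
proof
  assume "F \<noteq> {}"
  then obtain A where "A \<in> F" by blast
  then show "has_chain F (Suc 0)"
    unfolding has_chain_def by (intro exI[of _ "\<lambda>_. A"]) (auto simp: strict_mono_on_def)
qed (auto simp: has_chain_def Pi_iff)

section \<open>Descent through half-open intervals\<close>

lemma has_chain_insert_bottom:
  assumes "has_chain G l" "X \<in> F" "G \<subseteq> F" "\<And>A. A \<in> G \<Longrightarrow> X \<subset> A"
  shows "has_chain F (Suc l)"
proof -
  obtain f where f: "f \<in> {1..l} \<rightarrow> G" "strict_mono_on {1..l} f"
    using assms(1) by (auto simp: has_chain_def)
  define g where "g p = (if p = 1 then X else f (p - 1))" for p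
  have fG: "f (p - 1) \<in> G" if "p \<in> {1..Suc l}" "p \<noteq> 1" for p
    by (rule funcset_mem[OF f(1)]) (use that in auto)
  have "g \<in> {1..Suc l} \<rightarrow> F"
  proof
    fix p assume "p \<in> {1..Suc l}"
    then show "g p \<in> F" using fG[of p] assms(2,3) unfolding g_def by (cases "p = 1") auto
  qed
  moreover have "strict_mono_on {1..Suc l} g"
  proof (rule strict_mono_onI)
    fix p q assume pq: "p \<in> {1..Suc l}" "q \<in> {1..Suc l}" "p < q"
    show "g p < g q"
    proof (cases "p = 1")
      case True
      then show ?thesis using pq assms(4) fG[of q] by (auto simp: g_def)
    next
      case False
      then have "f (p - 1) < f (q - 1)"
        using pq by (intro strict_mono_onD[OF f(2)]) auto
      then show ?thesis using False pq by (simp add: g_def)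
    qed
  qed
  ultimately show ?thesis by (auto simp: has_chain_def)
qed

text \<open>Here \<open>F\<close> is a colour class met for the first time at \<open>X\<close>, and
  \<open>h\<close> is its new budget, replacing \<open>n\<close>. The inequality says that the
  dimension falls by no more than the budget does; the additive form avoids truncated
  subtraction.\<close>

lemma shrink_interval:
  assumes "finite Y" "X \<in> F" "X \<subset> Y" "1 \<le> m" "1 \<le> n" "m = 1 \<and> n = 1 \<or> m < n"
    and noV: "\<not> has_V F m n"
  obtains X' Y' h where "X \<subseteq> X'" "X' \<subseteq> Y'" "Y' \<subseteq> Y" "\<not> has_chain (seg F X' Y') (Suc h)"
    "card (Y - X) + h \<le> card (Y' - X') + n" "card (Y' - X') < card (Y - X)"
proof -
  note result = that
  have card_insert: "card (Y - X) = Suc (card (Y - insert b X))" if "b \<in> Y - X" for b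
  proof -
    have "Y - insert b X = (Y - X) - {b}" by blast
    then show ?thesis using card_Suc_Diff1[of "Y - X" b] that assms(1) by simp
  qed
  have add_point: thesis if "b \<in> Y - X" "\<not> has_chain (seg F (insert b X) Y) n" for b
    using that(1) assms(3,5) that(2) card_insert[OF that(1)]
    by (intro result[of "insert b X" Y "n - 1"]) auto
  show thesis
  proof (cases "has_chain {A \<in> F. X \<subset> A \<and> A \<subset> Y} n")
    case False
    obtain b where b: "b \<in> Y - X" using assms(3) by blast
    then have "seg F (insert b X) Y \<subseteq> {A \<in> F. X \<subset> A \<and> A \<subset> Y}"
      by (auto simp: seg_def)
    with False b show thesis
      using add_point has_chain_mono by blast
  next
    case chain: True
    show thesis
    proof (cases "m < n")
      case False
      then have [simp]: "m = 1" "n = 1" using assms(6) by auto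
      let ?G = "{A \<in> F. X \<subset> A \<and> A \<subset> Y}"
      have nonempty: "?G \<noteq> {}" using chain by (simp add: has_chain_one)
      have "finite ?G"
        by (rule finite_subset[of _ "Pow Y"]) (use assms(1) in auto)
      from finite_has_maximal[OF this nonempty]
      obtain w where w: "w \<in> ?G" and max: "\<forall>A\<in>?G. w \<subseteq> A \<longrightarrow> w = A" ..
      obtain b where b: "b \<in> Y - w" using w by blast
      have "seg F (insert b X) Y = {}"
      proof (rule equals0I)
        fix A assume "A \<in> seg F (insert b X) Y"
        then have A: "A \<in> ?G" "b \<in> A" using b w by (auto simp: seg_def)
        \<comment> \<open>Since \<open>b\<close> lies in \<open>A\<close> but not in
          \<open>w\<close>, the sets differ and \<open>A\<close> is not below \<open>w\<close>;
          maximality of \<open>w\<close> excludes the other inclusion.\<close>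
        have "\<not> w \<subseteq> A" "\<not> A \<subseteq> w" using A b max by auto
        moreover have "strict_mono_on {1..1::nat} (\<lambda>_. B)" for B :: "'a set"
          by (simp add: strict_mono_on_def)
        ultimately have "has_V F 1 1"
          unfolding has_V_def using A w assms(2)
          by (intro bexI[of _ X] exI[of _ "\<lambda>_. A"] exI[of _ "\<lambda>_. w"]) auto
        then show False using noV by simp
      qed
      then show thesis
        using b w by (intro add_point[of b]) (auto simp: has_chain_one)
    next
      case True
      obtain w where w: "w \<in> {1..n} \<rightarrow> {A \<in> F. X \<subset> A \<and> A \<subset> Y}" "strict_mono_on {1..n} w"
        using chain by (auto simp: has_chain_def)
      have w_in: "w j \<in> F \<and> X \<subset> w j \<and> w j \<subset> Y" if "j \<in> {1..n}" for j
        using w(1) that by (auto simp: Pi_iff)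
      have w_le: "w 1 \<subseteq> w j \<and> w j \<subseteq> w n" if "j \<in> {1..n}" for j
        using strict_mono_on_imp_mono_on[OF w(2)] that by (auto simp: mono_on_def)
      obtain b where b: "b \<in> Y" "b \<notin> w n" using w_in[of n] assms(5) by auto
      obtain q where q: "q \<in> w 1" "q \<notin> X" using w_in[of 1] assms(5) by auto
      have bq: "b \<notin> X" "q \<in> Y" "b \<noteq> q"
        using b q w_in[of 1] w_in[of n] w_le[of n] assms(5) by auto
      have "\<not> has_chain (seg F (insert b X) (Y - {q})) m"
      proof
        assume "has_chain (seg F (insert b X) (Y - {q})) m"
        then obtain f where f: "f \<in> {1..m} \<rightarrow> seg F (insert b X) (Y - {q})"
          "strict_mono_on {1..m} f" by (auto simp: has_chain_def)
        have f_in: "f p \<in> F \<and> X \<subset> f p \<and> b \<in> f p \<and> q \<notin> f p" if "p \<in> {1..m}" for p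
          using f(1) that bq by (auto simp: Pi_iff seg_def)
        \<comment> \<open>The point \<open>b\<close> is in \<open>f p\<close> but not in
          \<open>w n\<close>, hence not in \<open>w j\<close>; the point \<open>q\<close> is in
          \<open>w 1\<close>, hence in \<open>w j\<close>, but not in \<open>f p\<close>.\<close>
        have "\<not> f p \<subseteq> w j \<and> \<not> w j \<subseteq> f p" if "p \<in> {1..m}" "j \<in> {1..n}" for p j
          using f_in[OF that(1)] w_le[OF that(2)] b q by blast
        then have "has_V F m n"
          unfolding has_V_def using f_in w_in f(2) w(2) assms(2)
          by (intro bexI[of _ X] exI[of _ f] exI[of _ w]) auto
        with noV show False ..
      qed
      moreover have "card (Y - X) = Suc (Suc (card (Y - {q} - insert b X)))"
      proof -
        have "Y - {q} - insert b X = (Y - insert b X) - {q}" by blast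
        then show ?thesis
          using card_insert[of b] card_Suc_Diff1[of "Y - insert b X" q] b q bq assms(1) by simp
      qed
      \<comment> \<open>The accounts balance because \<open>2 + (m - 1) \<le> n\<close> when
        \<open>m < n\<close>.\<close>
      ultimately show thesis
        using True assms(3,4) b q bq
        by (intro result[of "insert b X" "Y - {q}" "m - 1"]) auto
    qed
  qed
qed

text \<open>The set \<open>U\<close> consists of the colours that have not been met yet.\<close>

lemma budget_le_card:
  assumes "finite Y" "X \<subseteq> Y" "finite K" "1 \<le> m" "1 \<le> n" "m = 1 \<and> n = 1 \<or> m < n"
    and noV: "\<And>i. i \<in> K \<Longrightarrow> \<not> has_V (F i) m n"
    and cover: "\<And>A. X \<subseteq> A \<Longrightarrow> A \<subset> Y \<Longrightarrow> \<exists>i\<in>K. A \<in> F i"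
    and fresh: "\<And>i. i \<in> U \<Longrightarrow> h i = n"
    and met: "\<And>i. i \<in> K - U \<Longrightarrow> \<not> has_chain (seg (F i) X Y) (Suc (h i))"
  shows "card (Y - X) \<le> sum h K"
  using assms(1,2) cover fresh met
\<comment> \<open>\<open>U\<close> and \<open>h\<close> must vary too: each step marks the colour of
  \<open>X\<close> as met and resets its budget.\<close>
proof (induction "card (Y - X)" arbitrary: X Y U h rule: less_induct)
  case less
  show ?case
  proof (cases "X = Y")
    case True
    then show ?thesis by simp
  next
    case False
    then have XY: "X \<subset> Y" using less.prems by blast
    then obtain i where i: "i \<in> K" "X \<in> F i" using less.prems(3) by blast
    have sum_split: "sum g K = g i + sum g (K - {i})" for g :: "_ \<Rightarrow> nat"
      using assms(3) i(1) by (rule sum.remove)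
    have sum_upd: "sum (h(i := l)) K = l + sum h (K - {i})" for l
      by (subst sum_split) (auto intro!: sum.cong)
    \<comment> \<open>Only the budget of \<open>i\<close> changes. Every other met colour keeps its
      budget, since its part of the interval can only shrink.\<close>
    have step: "card (Y' - X') \<le> l + sum h (K - {i})"
      if "X \<subseteq> X'" "X' \<subseteq> Y'" "Y' \<subseteq> Y" "card (Y' - X') < card (Y - X)"
        "\<not> has_chain (seg (F i) X' Y') (Suc l)" for X' Y' l
    proof -
      have "card (Y' - X') \<le> sum (h(i := l)) K"
      proof (rule less.hyps[where U = "U - {i}"])
        show "finite Y'" using less.prems(1) that(3) by (rule rev_finite_subset)
        show "\<exists>i\<in>K. A \<in> F i" if "X' \<subseteq> A" "A \<subset> Y'" for A
          using that \<open>X \<subseteq> X'\<close> \<open>Y' \<subseteq> Y\<close> by (intro less.prems(3)) auto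
        show "\<not> has_chain (seg (F j) X' Y') (Suc ((h(i := l)) j))" if "j \<in> K - (U - {i})" for j
          using that \<open>\<not> has_chain (seg (F i) X' Y') (Suc l)\<close> less.prems(5)[of j]
            has_chain_mono[OF _ seg_mono[OF \<open>X \<subseteq> X'\<close> \<open>Y' \<subseteq> Y\<close>]]
          by auto
      qed (use that less.prems(4) in auto)
      then show ?thesis by (simp only: sum_upd)
    qed
    show ?thesis
    proof (cases "i \<in> U")
      case True
      obtain X' Y' l where "X \<subseteq> X'" "X' \<subseteq> Y'" "Y' \<subseteq> Y"
        "\<not> has_chain (seg (F i) X' Y') (Suc l)"
        "card (Y - X) + l \<le> card (Y' - X') + n" "card (Y' - X') < card (Y - X)"
        using shrink_interval[OF less.prems(1) i(2) XY assms(4-6) noV[OF i(1)]] by blast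
      with step[of X' Y' l] less.prems(4)[OF True] sum_split[of h] show ?thesis
        by linarith
    next
      case False
      then have bound: "\<not> has_chain (seg (F i) X Y) (Suc (h i))"
        using less.prems(5) i(1) by blast
      have X_seg: "X \<in> seg (F i) X Y" using i XY by (auto simp: seg_def)
      \<comment> \<open>The set \<open>X\<close> alone is a chain of length one, so the budget can
        really drop by one.\<close>
      have h: "h i \<noteq> 0"
      proof
        assume "h i = 0"
        with bound X_seg show False by (auto simp: has_chain_one)
      qed
      obtain b where b: "b \<in> Y - X" using XY by blast
      \<comment> \<open>A longer chain above \<open>insert b X\<close> could be extended downwards
        by \<open>X\<close>, exceeding the old budget.\<close>
      have "\<not> has_chain (seg (F i) (insert b X) Y) (Suc (h i - 1))"
      proof
        assume "has_chain (seg (F i) (insert b X) Y) (Suc (h i - 1))"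
        then have "has_chain (seg (F i) X Y) (Suc (Suc (h i - 1)))"
          by (rule has_chain_insert_bottom[OF _ X_seg]) (use b in \<open>auto simp: seg_def\<close>)
        with bound h show False by simp
      qed
      moreover have "card (Y - X) = Suc (card (Y - insert b X))"
      proof -
        have "Y - insert b X = (Y - X) - {b}" by blast
        then show ?thesis using card_Suc_Diff1[of "Y - X" b] b less.prems(1) by simp
      qed
      ultimately show ?thesis
        using step[of "insert b X" Y "h i - 1"] b XY h sum_split[of h] by force
    qed
  qed
qed

section \<open>Upper bound\<close>

lemma has_V_imp_embedding:
  assumes "has_V F m n" "F \<subseteq> Pow {1..N}"
  shows "\<exists>\<phi>. poset_embedding (V_poset m n) (boolean_lattice N) \<phi> \<and>
    (\<forall>x\<in>Field (V_poset m n). \<phi> x \<in> F)"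
proof -
  obtain x f g where x: "x \<in> F"
    and f: "f \<in> {1..m} \<rightarrow> F" "strict_mono_on {1..m} f" "\<And>p. p \<in> {1..m} \<Longrightarrow> x \<subset> f p"
    and g: "g \<in> {1..n} \<rightarrow> F" "strict_mono_on {1..n} g" "\<And>q. q \<in> {1..n} \<Longrightarrow> x \<subset> g q"
    and fg: "\<And>p q. p \<in> {1..m} \<Longrightarrow> q \<in> {1..n} \<Longrightarrow> \<not> f p \<subseteq> g q \<and> \<not> g q \<subseteq> f p"
    using assms(1) unfolding has_V_def by blast
  define \<phi> where "\<phi> a = (case a of V_x \<Rightarrow> x | V_y p \<Rightarrow> f p | V_z q \<Rightarrow> g q)" for a
  have \<phi>_in: "\<phi> a \<in> F" if "a \<in> V_carrier m n" for a
    using that x f(1) g(1) by (auto simp: V_carrier_def \<phi>_def Pi_iff)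
  have f_le: "f p \<subseteq> f q \<longleftrightarrow> p \<le> q" if "p \<in> {1..m}" "q \<in> {1..m}" for p q
    using strict_mono_on_less_eq[OF f(2) that] .
  have g_le: "g p \<subseteq> g q \<longleftrightarrow> p \<le> q" if "p \<in> {1..n}" "q \<in> {1..n}" for p q
    using strict_mono_on_less_eq[OF g(2) that] .
  have \<phi>_sub: "\<phi> a \<subseteq> {1..N}" if "a \<in> V_carrier m n" for a
    using \<phi>_in[OF that] assms(2) by blast
  have x_f: "x \<subseteq> f p" "\<not> f p \<subseteq> x" if "p \<in> {1..m}" for p
    using f(3)[OF that] by auto
  have x_g: "x \<subseteq> g q" "\<not> g q \<subseteq> x" if "q \<in> {1..n}" for q
    using g(3)[OF that] by auto
  have \<phi>_le: "\<phi> a \<subseteq> \<phi> b \<longleftrightarrow> V_le a b" if "a \<in> V_carrier m n" "b \<in> V_carrier m n" for a b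
    using that
    by (cases a; cases b) (auto simp: V_carrier_def \<phi>_def image_iff x_f x_g f_le g_le fg)
  have "inj_on \<phi> (V_carrier m n)"
    by (rule inj_onI) (use \<phi>_le V_le_antisym in blast)
  then have "poset_embedding (V_poset m n) (boolean_lattice N) \<phi>"
    using \<phi>_le \<phi>_sub unfolding poset_embedding_def Field_V_poset Field_boolean_lattice
    by (simp add: V_poset_iff boolean_lattice_def)
  with \<phi>_in show ?thesis by (auto simp: Field_V_poset)
qed

lemma ramsey_property_V:
  assumes "1 \<le> m" "1 \<le> n" "m = 1 \<and> n = 1 \<or> m < n" "n * k < N"
  shows "ramsey_property k (\<lambda>_. V_poset m n) N"
  unfolding ramsey_property_def
proof
  fix c assume c: "c \<in> Pow {1..N} \<rightarrow> {1..k}"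
  define F where "F i = {A \<in> Pow {1..N}. c A = i}" for i
  have "\<exists>i\<in>{1..k}. has_V (F i) m n"
  proof (rule ccontr)
    assume "\<not> ?thesis"
    \<comment> \<open>At the start every colour is fresh with budget \<open>n\<close>, so the
      condition on met colours is vacuous.\<close>
    then have "card ({1..N} - {}) \<le> sum (\<lambda>_. n) {1..k}"
      using c by (intro budget_le_card[OF _ _ _ assms(1-3), where F = F and U = "{1..k}"])
        (auto simp: F_def Pi_iff)
    then show False using assms(4) by (simp add: mult.commute)
  qed
  then obtain i where i: "i \<in> {1..k}" "has_V (F i) m n" by blast
  have "F i \<subseteq> Pow {1..N}" by (auto simp: F_def)
  with has_V_imp_embedding[OF i(2)] obtain \<phi>
    where "poset_embedding (V_poset m n) (boolean_lattice N) \<phi>"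
      "\<forall>x\<in>Field (V_poset m n). \<phi> x \<in> F i" by blast
  with i(1) show "\<exists>i\<in>{1..k}. \<exists>\<phi>. poset_embedding (V_poset m n) (boolean_lattice N) \<phi> \<and>
      (\<forall>x\<in>Field (V_poset m n). c (\<phi> x) = i)"
    by (intro bexI[of _ i] exI[of _ \<phi>]) (auto simp: F_def)
qed

section \<open>Lower bound\<close>

lemma not_ramsey_property_V:
  assumes "1 \<le> k" "1 \<le> m" "1 \<le> n" "N \<le> n * k"
  shows "\<not> ramsey_property k (\<lambda>_. V_poset m n) N"
proof
  define c where "c A = min (card A div n + 1) k" for A :: "nat set"
  assume "ramsey_property k (\<lambda>_. V_poset m n) N"
  moreover have "c \<in> Pow {1..N} \<rightarrow> {1..k}" using assms(1) by (auto simp: c_def)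
  ultimately obtain i \<phi> where emb: "poset_embedding (V_poset m n) (boolean_lattice N) \<phi>"
    and c: "\<And>a. a \<in> V_carrier m n \<Longrightarrow> c (\<phi> a) = i"
    unfolding ramsey_property_def Field_V_poset by blast
  have sub: "\<phi> a \<subseteq> {1..N}" if "a \<in> V_carrier m n" for a
    using emb that by (auto simp: poset_embedding_def Field_V_poset Field_boolean_lattice)
  then have fin: "finite (\<phi> a)" if "a \<in> V_carrier m n" for a
    using that finite_subset by blast
  have le: "\<phi> a \<subseteq> \<phi> b \<longleftrightarrow> V_le a b" if "a \<in> V_carrier m n" "b \<in> V_carrier m n" for a b
    using emb that sub
    by (auto simp: poset_embedding_def Field_V_poset V_poset_iff boolean_lattice_def)
  have mem: "V_x \<in> V_carrier m n" "V_y 1 \<in> V_carrier m n"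
    "\<And>q. 1 \<le> q \<Longrightarrow> q \<le> n \<Longrightarrow> V_z q \<in> V_carrier m n"
    using assms(2) by (auto simp: V_carrier_def)
  have less: "card (\<phi> a) < card (\<phi> b)"
    if "a \<in> V_carrier m n" "b \<in> V_carrier m n" "V_le a b" "\<not> V_le b a" for a b
    using le that by (intro psubset_card_mono fin) auto
  have "q \<le> n \<longrightarrow> card (\<phi> V_x) + q \<le> card (\<phi> (V_z q))" if "1 \<le> q" for q
    using that
  proof (induction q rule: dec_induct)
    case base
    show ?case using less[of V_x "V_z 1"] mem by auto
  next
    case (step q)
    then show ?case using less[of "V_z q" "V_z (Suc q)"] mem by auto
  qed
  then have top: "card (\<phi> V_x) + n \<le> card (\<phi> (V_z n))" using assms(3) by simp
  \<comment> \<open>Climbing \<open>n\<close> levels raises the quotient by at least one, so the two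
    colours can agree only if the cap \<open>k\<close> applies already at
    \<open>V_x\<close>.\<close>
  have "card (\<phi> V_x) div n + 1 \<le> card (\<phi> (V_z n)) div n"
    using div_le_mono[OF top, of n] assms(3) by simp
  moreover have "c (\<phi> V_x) = c (\<phi> (V_z n))" using c mem assms(3) by simp
  ultimately have "k \<le> card (\<phi> V_x) div n + 1"
    by (auto simp: c_def min_def split: if_splits)
  then have "k \<le> card (\<phi> (V_z n)) div n"
    using \<open>card (\<phi> V_x) div n + 1 \<le> _\<close> by linarith
  then have "n * k \<le> card (\<phi> (V_z n))"
    using assms(3) by (simp add: less_eq_div_iff_mult_less_eq mult.commute)
  \<comment> \<open>A subset of \<open>{1..N}\<close> with at least \<open>n * k \<ge> N\<close>
    elements is everything, so it contains the image of \<open>V_y 1\<close>, which should be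
    incomparable to it.\<close>
  then have "\<phi> (V_z n) = {1..N}"
    using sub[of "V_z n"] mem(3)[of n] assms(3,4) by (intro card_seteq) auto
  then have "\<phi> (V_y 1) \<subseteq> \<phi> (V_z n)" using sub mem(2) by simp
  then show False using le mem assms(3) by simp
qed

theorem theorem1:
  fixes k m n :: nat
  assumes "1 \<le> k" and "1 \<le> m" and "m \<le> n"
    and "(m = 1 \<and> n = 1) \<or> m < n"
  shows "poset_ramsey_diag k (V_poset m n) = enat (n * k + 1)"
  unfolding poset_ramsey_diag_def poset_ramsey_def
proof (rule cInf_eq_minimum)
  have n: "1 \<le> n" using assms by linarith
  show "enat (n * k + 1) \<in> enat ` {N. ramsey_property k (\<lambda>_. V_poset m n) N}"
    using ramsey_property_V[OF assms(2) n assms(4)] by simp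
  fix e assume "e \<in> enat ` {N. ramsey_property k (\<lambda>_. V_poset m n) N}"
  then obtain N where "e = enat N" "ramsey_property k (\<lambda>_. V_poset m n) N" by blast
  then show "enat (n * k + 1) \<le> e"
    using not_ramsey_property_V[OF assms(1,2) n, of N] by fastforce
qed

end
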